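(* Let $\boldsymbol{\xi}$ be a fixed parameter value and let $f$ satisfy, for some constant $L>0$, the one-sided Lipschitz condition $$\langle f(v_1,t,\boldsymbol{\xi})-f(v_2,t,\boldsymbol{\xi}),\,v_1-v_2\rangle\le -L\|v_1-v_2\|_2^2\qquad\text{for all } v_1,v_2\in\mathbb{R}^{N_x},\ t\ge 0 .$$ Let $u(\cdot;\boldsymbol{\xi})$ be the solution of $u'(t,\boldsymbol{\xi})=f(u(t,\boldsymbol{\xi}),t,\boldsymbol{\xi})$, $u(0,\boldsymbol{\xi})=u_0(\boldsymbol{\xi})$, let $\alpha\in(0,1)$, and let $\mathrm{U}_n^k(\boldsymbol{\xi})$, $n=1,\dots,N$, $k\ge0$, be the iterates of the parareal algorithm with parallel (diagonalization-based) coarse grid correction, where the fine propagator $\mathcal{F}$ is the exact solver, the coarse propagator $\mathcal{G}$ is the backward-Euler method with step $\Delta T$, and the coarse correction is subject to $\mathrm{U}_0^{k}=\alpha\mathrm{U}_N^{k}$, as defined in the context. Suppose $\frac{|\alpha|}{1+L\Delta T}<1$ and $N\gg1$ (that is, $N$ is sufficiently large), and suppose that for some $\delta>0$ the initial guess satisfies $$\max_{n=1,\dots,N}\|u(T_n;\boldsymbol{\xi})-\mathrm{U}_n^0(\boldsymbol{\xi})\|_2\le\delta .$$ Then for every $k\ge 0$ $$\max_{n=1,2,\dots,N}\|u(T_n;\boldsymbol{\xi})-\mathrm{U}_n^{k+1}(\boldsymbol{\xi})\|_2\le \rho(\alpha)^{k+1}\,\delta,$$ where $$\rho(\alpha)=\max\left\{|\alpha|\,\frac{1+e^{-L\Delta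 T}}{L\Delta T},\ \frac{e^{-L\Delta T}+\frac{1}{1+L\Delta T}}{1-\frac{1}{1+L\Delta T}}\right\}$$ depends only on $L$, $\Delta T$ and $\alpha$.
   Context: The interval $[0,T]$ is divided into $N$ equal subintervals $[T_n,T_{n+1}]$, $T_n=n\Delta T$, $T=N\Delta T$. Here $f(\cdot,\cdot,\boldsymbol{\xi}):\mathbb{R}^{N_x}\times\mathbb{R}^+\to\mathbb{R}^{N_x}$ and $\langle\cdot,\cdot\rangle$, $\|\cdot\|_2$ are the Euclidean inner product and norm. Propagators. $\mathcal{F}(T_n,T_{n+1},v)$ is the value at $T_{n+1}$ of the exact solution of $w'=f(w,t,\boldsymbol{\xi})$ with $w(T_n)=v$. $\mathcal{G}(T_n,T_{n+1},v)=s$ is one backward-Euler step of size $\Delta T$: $s$ solves $(s-v)/\Delta T=f(s,T_{*},\boldsymbol{\xi})$, where $T_*$ is the time node associated with the subinterval (the paper writes $T_*=T_n$). Algorithm. Given an initial guess $\{\mathrm{U}_n^0(\boldsymbol{\xi})\}_{n=1}^N$ (for example produced by a Karhunen-Loève/polynomial chaos surrogate), for $k=0,1,\dots$: put $\tilde{\mathrm{U}}_n^k=\mathcal{F}(T_n,T_{n+1},\mathrm{U}_n^k)$ for $1\le n\le N-1$ and $\tilde{\mathrm{U}}_0^k=\mathcal{F}(T_0,T_1,u_0(\boldsymbol{\xi}))$ (the fine propagator uses the true initial value at $T_0$). The new iterate $(\mathrm{U}_n^{k+1})_{n=1}^N$ is the solution of the coupled system $$\mathrm{U}_{n+1}^{k+1}=\mathcal{G}(T_n,T_{n+1},\mathrm{U}_n^{k+1})+\tilde{\mathrm{U}}_n^k-\mathcal{G}(T_n,T_{n+1},\mathrm{U}_n^k),\quad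 n=0,\dots,N-1,$$ with $\mathrm{U}_0^{k+1}=\alpha\mathrm{U}_N^{k+1}$ and $\mathrm{U}_0^k=\alpha\mathrm{U}_N^k$. *)

theory Defs
  imports "HOL-Analysis.Analysis"
begin

definition one_sided_Lipschitz ::
  "real \<Rightarrow> ('v::real_inner \<Rightarrow> real \<Rightarrow> 'v) \<Rightarrow> bool" where
  "one_sided_Lipschitz L g \<longleftrightarrow>
     (\<forall>v1 v2. \<forall>t\<ge>0. (g v1 t - g v2 t) \<bullet> (v1 - v2) \<le> - L * (norm (v1 - v2))\<^sup>2)"

definition solves_ode_on ::
  "('v::real_normed_vector \<Rightarrow> real \<Rightarrow> 'v) \<Rightarrow> real \<Rightarrow> real \<Rightarrow> (real \<Rightarrow> 'v) \<Rightarrow> bool" where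
  "solves_ode_on g a b w \<longleftrightarrow>
     (\<forall>t\<in>{a..b}. (w has_vector_derivative g (w t) t) (at t within {a..b}))"

text \<open>
  The two propagators are given as relations between the input value and the
  propagated value.  Under a one-sided Lipschitz condition (with \<open>0 \<le> a \<le> b\<close>,
  \<open>0 < h\<close> and \<open>0 \<le> t\<close>) both are single-valued.  That condition alone does not provide
  existence of the values (no continuity of the right-hand side is required), so
  existence is asserted exactly where the algorithm evaluates a propagator.
\<close>

definition fine_propagates ::
  "('v::real_normed_vector \<Rightarrow> real \<Rightarrow> 'v) \<Rightarrow> real \<Rightarrow> real \<Rightarrow> 'v \<Rightarrow> 'v \<Rightarrow> bool" where
  "fine_propagates g a b v y \<longleftrightarrow> (\<exists>w. solves_ode_on g a b w \<and> w a = v \<and> w b = y)"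

definition backward_Euler_step ::
  "('v::real_normed_vector \<Rightarrow> real \<Rightarrow> 'v) \<Rightarrow> real \<Rightarrow> real \<Rightarrow> 'v \<Rightarrow> 'v \<Rightarrow> bool" where
  "backward_Euler_step g h t v s \<longleftrightarrow> (s - v) /\<^sub>R h = g s t"

definition time_node :: "real \<Rightarrow> nat \<Rightarrow> real" where
  "time_node h n = real n * h"

text \<open>
  \<open>U k n\<close> is the \<open>k\<close>-th iterate at the \<open>n\<close>-th time node, and \<open>\<tau> n\<close> is the time at which
  the backward Euler step on the \<open>n\<close>-th subinterval evaluates the right-hand side.  On the first
  subinterval the fine propagator starts from the true initial value \<open>v0\<close>, whereas
  the coarse propagator starts from \<open>U k 0 = \<alpha> U k N\<close>.
  In the second clause \<open>y\<close> is the fine value, and \<open>s'\<close> and \<open>s\<close> are the coarse values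
  of the new and of the old iterate.  The case \<open>k = 0\<close> of \<open>U k n\<close> with \<open>1 \<le> n \<le> N\<close> is the
  arbitrary initial guess.
\<close>

definition parareal_iterates ::
  "('v::real_normed_vector \<Rightarrow> real \<Rightarrow> 'v) \<Rightarrow> real \<Rightarrow> nat \<Rightarrow> (nat \<Rightarrow> real) \<Rightarrow> real \<Rightarrow> 'v
     \<Rightarrow> (nat \<Rightarrow> nat \<Rightarrow> 'v) \<Rightarrow> bool" where
  "parareal_iterates g h N \<tau> \<alpha> v0 U \<longleftrightarrow>
     (\<forall>k. U k 0 = \<alpha> *\<^sub>R U k N) \<and>
     (\<forall>k. \<forall>n<N. \<exists>y s' s.
        fine_propagates g (time_node h n) (time_node h (Suc n)) (if n = 0 then v0 else U k n) y \<and>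
        backward_Euler_step g h (\<tau> n) (U (Suc k) n) s' \<and>
        backward_Euler_step g h (\<tau> n) (U k n) s \<and>
        U (Suc k) (Suc n) = s' + y - s)"

definition parareal_rho :: "real \<Rightarrow> real \<Rightarrow> real \<Rightarrow> real" where
  "parareal_rho L h \<alpha> =
     max (\<bar>\<alpha>\<bar> * ((1 + exp (- L * h)) / (L * h)))
         ((exp (- L * h) + 1 / (1 + L * h)) / (1 - 1 / (1 + L * h)))"

end

theory Submission
  imports Defs
begin

text \<open>
  Write \<open>r = 1 / (1 + L * \<Delta>T)\<close> and \<open>e = exp (- L * \<Delta>T)\<close>.  Under the one-sided Lipschitz condition
  one backward Euler step contracts distances by \<open>r\<close> and the exact flow over one subinterval by \<open>e\<close>.
  If the errors of the \<open>k\<close>-th iterate are at most \<open>M\<close>, the errors \<open>x n\<close> of the next iterate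
  therefore satisfy \<open>x (n + 1) \<le> (e + r) * M + r * x n\<close> for \<open>1 \<le> n < N\<close>, and, since the exact
  initial value cancels the fine propagator on the first subinterval,
  \<open>x 1 \<le> r * \<bar>\<alpha>\<bar> * (M + x N)\<close>.  At an index where \<open>x\<close> is maximal, with value \<open>X\<close>, either bound gives
  \<open>X \<le> (e + r) * M + r * X\<close>, so \<open>X\<close> is at most \<open>M\<close> times the second term of the maximum
  defining \<open>\<rho>\<close>, and this holds for every \<open>N \<ge> 1\<close>.
\<close>

lemma solves_ode_on_subset:
  assumes "solves_ode_on g a b w" "{c..d} \<subseteq> {a..b}"
  shows "solves_ode_on g c d w"
  using assms unfolding solves_ode_on_def
  by (meson has_vector_derivative_within_subset subsetD)

text \<open>Gronwall with an integrating factor: for \<open>d = v - w\<close>, the derivative of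
  \<open>exp (2 * L * t) * (d t \<bullet> d t)\<close> is twice the exponential times
  \<open>d' \<bullet> d + L * (d \<bullet> d)\<close>, and the one-sided condition says exactly that
  this is at most 0.\<close>

lemma ode_flow_contraction:
  fixes g :: "'v::real_inner \<Rightarrow> real \<Rightarrow> 'v"
  assumes lip: "one_sided_Lipschitz L g"
    and v: "solves_ode_on g a b v" and w: "solves_ode_on g a b w"
    and ab: "0 \<le> a" "a \<le> b"
  shows "norm (v b - w b) \<le> exp (- L * (b - a)) * norm (v a - w a)"
proof -
  define \<phi> where "\<phi> t = exp (2 * L * t) * ((v t - w t) \<bullet> (v t - w t))" for t
  have deriv: "((\<lambda>t. v t - w t) has_vector_derivative g (v t) t - g (w t) t) (at t within {a..b})"
    if "t \<in> {a..b}" for t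
    using v w that unfolding solves_ode_on_def by (intro has_vector_derivative_diff) auto
  have "continuous_on {a..b} v" "continuous_on {a..b} w"
    using v w has_vector_derivative_continuous
    unfolding solves_ode_on_def continuous_on_eq_continuous_within by blast+
  then have cont: "continuous_on {a..b} \<phi>"
    unfolding \<phi>_def by (intro continuous_intros)
  \<comment> \<open>A two-sided derivative is available only at interior points; the endpoints are
    reached through \<open>cont\<close>.\<close>
  have nonpos: "\<exists>y. (\<phi> has_real_derivative y) (at t) \<and> y \<le> 0" if t: "a < t" "t < b" for t
  proof -
    let ?d = "v t - w t" and ?d' = "g (v t) t - g (w t) t"
    have "at t within {a..b} = at t"
      using t by (intro at_within_interior) (simp add: interior_atLeastAtMost_real)
    then have "((\<lambda>t. v t - w t) has_derivative (\<lambda>s. s *\<^sub>R ?d')) (at t)"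
      using deriv[of t] t by (simp add: has_vector_derivative_def)
    note inner = has_derivative_inner[OF this this]
    have sq: "((\<lambda>t. (v t - w t) \<bullet> (v t - w t)) has_real_derivative 2 * (?d' \<bullet> ?d)) (at t)"
      unfolding has_field_derivative_def
      by (rule has_derivative_eq_rhs[OF inner]) (auto simp: fun_eq_iff inner_commute)
    have "((\<lambda>t. exp (2 * L * t)) has_real_derivative 2 * L * exp (2 * L * t)) (at t)"
      by (auto intro!: derivative_eq_intros)
    from DERIV_mult[OF this sq] have "(\<phi> has_real_derivative
        2 * exp (2 * L * t) * (?d' \<bullet> ?d + L * (?d \<bullet> ?d))) (at t)"
      unfolding \<phi>_def by (rule DERIV_cong) (simp add: distrib_left mult_ac)
    moreover have "?d' \<bullet> ?d + L * (?d \<bullet> ?d) \<le> 0"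
      using lip t ab unfolding one_sided_Lipschitz_def
      by (smt (verit) power2_norm_eq_inner mult_minus_left)
    then have "2 * exp (2 * L * t) * (?d' \<bullet> ?d + L * (?d \<bullet> ?d)) \<le> 0"
      by (simp add: mult_nonneg_nonpos)
    ultimately show ?thesis
      by blast
  qed
  have "\<phi> b \<le> \<phi> a"
    using DERIV_nonpos_imp_decreasing_open[OF ab(2) nonpos cont] .
  \<comment> \<open>As a square of a nonnegative quantity, \<phi> passes its monotonicity on to the
    weighted norms.\<close>
  moreover have "\<phi> t = (exp (L * t) * norm (v t - w t))\<^sup>2" for t
    by (simp add: \<phi>_def power_mult_distrib power2_norm_eq_inner flip: exp_double)
  ultimately have "exp (L * b) * norm (v b - w b) \<le> exp (L * a) * norm (v a - w a)"
    by (simp add: power2_le_iff_abs_le)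
  then have "exp (- L * b) * (exp (L * b) * norm (v b - w b))
      \<le> exp (- L * b) * (exp (L * a) * norm (v a - w a))"
    by (intro mult_left_mono) auto
  then show ?thesis
    by (simp add: algebra_simps flip: mult.assoc exp_add)
qed

text \<open>The step evaluates \<open>g\<close> at its output, so subtracting the two step equations
  and pairing with \<open>s - s'\<close> brings in the one-sided condition at the outputs.
  Cauchy-Schwarz then leaves one factor \<open>norm (s - s')\<close> to cancel.\<close>

lemma backward_Euler_step_contraction:
  fixes g :: "'v::real_inner \<Rightarrow> real \<Rightarrow> 'v"
  assumes lip: "one_sided_Lipschitz L g" and "0 \<le> L" "0 < h" "0 \<le> t"
    and s: "backward_Euler_step g h t v s" and s': "backward_Euler_step g h t v' s'"
  shows "norm (s - s') \<le> 1 / (1 + L * h) * norm (v - v')"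
proof -
  let ?d = "s - s'"
  have "s - v = h *\<^sub>R g s t" "s' - v' = h *\<^sub>R g s' t"
    using s s' \<open>0 < h\<close> unfolding backward_Euler_step_def by (auto simp: divideR_right dest: sym)
  then have "?d - (v - v') = h *\<^sub>R (g s t - g s' t)"
    by (simp add: algebra_simps)
  then have "(?d - (v - v')) \<bullet> ?d = h * ((g s t - g s' t) \<bullet> ?d)"
    by simp
  also have "\<dots> \<le> h * (- L * (norm ?d)\<^sup>2)"
    using lip \<open>0 < h\<close> \<open>0 \<le> t\<close> unfolding one_sided_Lipschitz_def
    by (intro mult_left_mono) auto
  finally have "(1 + L * h) * (norm ?d)\<^sup>2 \<le> (v - v') \<bullet> ?d"
    by (simp add: inner_diff_left[of ?d] power2_norm_eq_inner algebra_simps)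
  also have "\<dots> \<le> norm (v - v') * norm ?d"
    by (rule norm_cauchy_schwarz)
  finally have "((1 + L * h) * norm ?d) * norm ?d \<le> norm (v - v') * norm ?d"
    by (simp add: power2_eq_square mult.assoc)
  then have "(1 + L * h) * norm ?d \<le> norm (v - v')"
    by (cases "norm ?d = 0") (auto simp: mult_le_cancel_right)
  moreover have "0 < 1 + L * h"
    using assms by (simp add: add_pos_nonneg)
  ultimately show ?thesis
    by (simp add: field_simps)
qed

text \<open>Since \<open>x 1\<close> is controlled by \<open>x N\<close>, the recursion closes into
  a cycle with no known starting value. A maximum argument replaces unrolling: \<open>r < 1\<close>
  lets the maximum be absorbed on the left.\<close>

lemma cyclic_recursion_bound:
  fixes x :: "nat \<Rightarrow> real"
  assumes "0 \<le> \<beta>" "\<beta> \<le> 1" "0 \<le> r" "r < 1" "0 \<le> e" "0 \<le> M"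
    and nonneg: "\<And>n. 0 \<le> x n"
    and first: "x 1 \<le> r * (\<beta> * (M + x N))"
    and step: "\<And>n. 1 \<le> n \<Longrightarrow> n < N \<Longrightarrow> x (Suc n) \<le> e * M + r * (M + x n)"
    and n: "n \<in> {1..N}"
  shows "x n \<le> (e + r) / (1 - r) * M"
proof -
  define X where "X = Max (x ` {1..N})"
  have le_X: "x m \<le> X" if "m \<in> {1..N}" for m
    using that by (simp add: X_def)
  have "X \<in> x ` {1..N}"
    unfolding X_def using n by (intro Max_in) auto
  then obtain m where m: "m \<in> {1..N}" "x m = X"
    by auto
  have "X \<le> e * M + r * (M + X)"
  proof (cases "m = 1")
    case True
    \<comment> \<open>Bounding \<beta> by 1 and adding the nonnegative \<open>e * M\<close> brings
      this case to the same inequality as the other one.\<close>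
    have "X \<le> r * (\<beta> * (M + x N))"
      using first m True by simp
    also have "\<dots> \<le> r * (M + x N)"
      using assms nonneg[of N] by (intro mult_left_mono mult_left_le_one_le) auto
    also have "\<dots> \<le> r * (M + X)"
      using le_X[of N] n \<open>0 \<le> r\<close> by (intro mult_left_mono) auto
    also have "\<dots> \<le> e * M + r * (M + X)"
      using assms by simp
    finally show ?thesis .
  next
    case False
    then obtain l where l: "m = Suc l" "1 \<le> l" "l < N"
      using m by (cases m) auto
    have "X \<le> e * M + r * (M + x l)"
      using step[of l] l m by simp
    also have "\<dots> \<le> e * M + r * (M + X)"
      using le_X[of l] l \<open>0 \<le> r\<close> by (simp add: mult_left_mono)
    finally show ?thesis .
  qed
  then have "X \<le> (e + r) / (1 - r) * M"
    using \<open>r < 1\<close> by (simp add: field_simps)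
  then show ?thesis
    using le_X[OF n] by simp
qed

text \<open>The exact solution is its own fine propagation, so the new error splits into a
  difference of fine values and a difference of coarse values, each controlled by its contraction
  lemma.\<close>

lemma parareal_error_step:
  fixes g :: "'v::real_inner \<Rightarrow> real \<Rightarrow> 'v"
  assumes L: "0 < L" and h: "0 < h" and \<alpha>: "\<bar>\<alpha>\<bar> \<le> 1"
    and lip: "one_sided_Lipschitz L g"
    and u: "solves_ode_on g 0 (time_node h N) u"
    and \<tau>: "\<And>n. n < N \<Longrightarrow> 0 \<le> \<tau> n"
    and U: "parareal_iterates g h N \<tau> \<alpha> (u 0) U"
    and M: "\<And>n. n \<in> {1..N} \<Longrightarrow> norm (u (time_node h n) - U k n) \<le> M"
    and n: "n \<in> {1..N}"
  shows "norm (u (time_node h n) - U (Suc k) n) \<le> parareal_rho L h \<alpha> * M"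
proof -
  define e where "e = exp (- L * h)"
  define r where "r = 1 / (1 + L * h)"
  define x where "x m = norm (u (time_node h m) - U (Suc k) m)" for m
  have r: "0 \<le> r" "r < 1"
    using L h by (auto simp: r_def field_simps add_pos_pos)
  have M0: "0 \<le> M"
    using M[OF n] norm_ge_zero order_trans by blast
  have cyc: "U j 0 = \<alpha> *\<^sub>R U j N" for j
    using U unfolding parareal_iterates_def by blast
  \<comment> \<open>The coarse inputs are two successive iterates; their distance is measured
    through the exact solution.\<close>
  have diff: "norm (U k m - U (Suc k) m) \<le> M + x m" if "m \<in> {1..N}" for m
    using norm_triangle_ineq4[of "u (time_node h m) - U (Suc k) m" "u (time_node h m) - U k m"]
      M[OF that] by (simp add: x_def)
  have err: "x (Suc m) \<le> e * norm (u (time_node h m) - (if m = 0 then u 0 else U k m))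
      + r * norm (U k m - U (Suc k) m)" if m: "m < N" for m
  proof -
    let ?a = "time_node h m" and ?b = "time_node h (Suc m)"
    let ?v = "if m = 0 then u 0 else U k m"
    obtain y s' s where y: "fine_propagates g ?a ?b ?v y"
      and s': "backward_Euler_step g h (\<tau> m) (U (Suc k) m) s'"
      and s: "backward_Euler_step g h (\<tau> m) (U k m) s"
      and eq: "U (Suc k) (Suc m) = s' + y - s"
      using U m unfolding parareal_iterates_def by blast
    obtain w where w: "solves_ode_on g ?a ?b w" "w ?a = ?v" "w ?b = y"
      using y unfolding fine_propagates_def by blast
    have nodes: "0 \<le> ?a" "?a \<le> ?b" "?b \<le> time_node h N" "?b - ?a = h"
      using h m mult_right_mono[of "real (Suc m)" "real N" h]
      by (auto simp: time_node_def algebra_simps)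
    then have "solves_ode_on g ?a ?b u"
      by (intro solves_ode_on_subset[OF u]) auto
    from ode_flow_contraction[OF lip this w(1)] nodes
    have fine: "norm (u ?b - y) \<le> e * norm (u ?a - ?v)"
      unfolding e_def w(2,3) by simp
    have coarse: "norm (s - s') \<le> r * norm (U k m - U (Suc k) m)"
      unfolding r_def
      using backward_Euler_step_contraction[OF lip _ h \<tau>[OF m] s s'] L by simp
    have "x (Suc m) = norm ((u ?b - y) + (s - s'))"
      by (simp add: x_def eq algebra_simps)
    also have "\<dots> \<le> norm (u ?b - y) + norm (s - s')"
      by (rule norm_triangle_ineq)
    finally show ?thesis
      using fine coarse by linarith
  qed
  have "x n \<le> (e + r) / (1 - r) * M"
  proof (rule cyclic_recursion_bound[where \<beta> = "\<bar>\<alpha>\<bar>" and N = N])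
    \<comment> \<open>At node 0 the fine term in \<open>err\<close> vanishes, both arguments being
      \<open>u 0\<close>; \<open>cyc\<close> then moves the coarse term to index
      \<open>N\<close>.\<close>
    have "x 1 \<le> r * norm (U k 0 - U (Suc k) 0)"
      using err[of 0] n by (simp add: time_node_def)
    also have "\<dots> = r * (\<bar>\<alpha>\<bar> * norm (U k N - U (Suc k) N))"
      by (simp add: cyc flip: scaleR_diff_right)
    also have "\<dots> \<le> r * (\<bar>\<alpha>\<bar> * (M + x N))"
      using diff[of N] n r by (intro mult_left_mono) auto
    finally show "x 1 \<le> r * (\<bar>\<alpha>\<bar> * (M + x N))" .
  next
    fix m assume m: "1 \<le> m" "m < N"
    have "x (Suc m) \<le> e * norm (u (time_node h m) - U k m) + r * norm (U k m - U (Suc k) m)"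
      using err[of m] m by simp
    also have "\<dots> \<le> e * M + r * (M + x m)"
      using M[of m] diff[of m] m r by (intro add_mono mult_left_mono) (auto simp: e_def)
    finally show "x (Suc m) \<le> e * M + r * (M + x m)" .
  qed (use \<alpha> r M0 n in \<open>auto simp: e_def x_def\<close>)
  also have "\<dots> \<le> parareal_rho L h \<alpha> * M"
    using M0 by (intro mult_right_mono) (auto simp: parareal_rho_def e_def r_def)
  finally show ?thesis
    by (simp add: x_def)
qed

theorem theorem4p4:
  fixes L \<Delta>T \<alpha> :: real
  assumes "L > 0" and "\<Delta>T > 0" and "0 < \<alpha>" and "\<alpha> < 1"
    and "\<bar>\<alpha>\<bar> / (1 + L * \<Delta>T) < 1"
  shows "\<exists>N0\<ge>1. \<forall>N\<ge>N0.
    \<forall>(\<xi> :: 'p)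
     (f :: real ^ 'n \<Rightarrow> real \<Rightarrow> 'p \<Rightarrow> real ^ 'n)
     (u\<^sub>0 :: 'p \<Rightarrow> real ^ 'n)
     (u :: real \<Rightarrow> 'p \<Rightarrow> real ^ 'n)
     (\<tau> :: nat \<Rightarrow> real)
     (U :: nat \<Rightarrow> nat \<Rightarrow> 'p \<Rightarrow> real ^ 'n)
     (\<delta> :: real).
      one_sided_Lipschitz L (\<lambda>v t. f v t \<xi>) \<longrightarrow>
      solves_ode_on (\<lambda>v t. f v t \<xi>) 0 (time_node \<Delta>T N) (\<lambda>t. u t \<xi>) \<longrightarrow>
      u 0 \<xi> = u\<^sub>0 \<xi> \<longrightarrow>
      (\<forall>n<N. \<tau> n \<in> {time_node \<Delta>T n, time_node \<Delta>T (Suc n)}) \<longrightarrow>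
      parareal_iterates (\<lambda>v t. f v t \<xi>) \<Delta>T N \<tau> \<alpha> (u\<^sub>0 \<xi>) (\<lambda>k n. U k n \<xi>) \<longrightarrow>
      \<delta> > 0 \<longrightarrow>
      (MAX n\<in>{1..N}. norm (u (time_node \<Delta>T n) \<xi> - U 0 n \<xi>)) \<le> \<delta> \<longrightarrow>
      (\<forall>k. (MAX n\<in>{1..N}. norm (u (time_node \<Delta>T n) \<xi> - U (k + 1) n \<xi>))
             \<le> parareal_rho L \<Delta>T \<alpha> ^ (k + 1) * \<delta>)"
proof (intro exI[of _ 1] conjI allI impI)
  \<comment> \<open>The threshold 1 makes \<open>{1..N}\<close> nonempty, so each \<open>MAX\<close>
    is a true maximum.\<close>
  fix N :: nat and \<xi> :: 'p and f :: "real ^ 'n \<Rightarrow> real \<Rightarrow> 'p \<Rightarrow> real ^ 'n"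
    and u\<^sub>0 :: "'p \<Rightarrow> real ^ 'n" and u :: "real \<Rightarrow> 'p \<Rightarrow> real ^ 'n" and \<tau> :: "nat \<Rightarrow> real"
    and U :: "nat \<Rightarrow> nat \<Rightarrow> 'p \<Rightarrow> real ^ 'n" and \<delta> :: real and k :: nat
  assume N: "1 \<le> N"
    and lip: "one_sided_Lipschitz L (\<lambda>v t. f v t \<xi>)"
    and u: "solves_ode_on (\<lambda>v t. f v t \<xi>) 0 (time_node \<Delta>T N) (\<lambda>t. u t \<xi>)"
    and u0: "u 0 \<xi> = u\<^sub>0 \<xi>"
    and \<tau>: "\<forall>n<N. \<tau> n \<in> {time_node \<Delta>T n, time_node \<Delta>T (Suc n)}"
    and U: "parareal_iterates (\<lambda>v t. f v t \<xi>) \<Delta>T N \<tau> \<alpha> (u\<^sub>0 \<xi>) (\<lambda>k n. U k n \<xi>)"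
    and init: "(MAX n\<in>{1..N}. norm (u (time_node \<Delta>T n) \<xi> - U 0 n \<xi>)) \<le> \<delta>"
  \<comment> \<open>The one-sided condition covers nonnegative times only; both admissible nodes are
    such times.\<close>
  have \<tau>0: "0 \<le> \<tau> n" if "n < N" for n
    using \<tau> that \<open>\<Delta>T > 0\<close> by (fastforce simp: time_node_def)
  \<comment> \<open>The maxima are replaced by bounds at each node, the form in which the step
    estimate can be iterated.\<close>
  have bound: "\<forall>n\<in>{1..N}. norm (u (time_node \<Delta>T n) \<xi> - U j n \<xi>) \<le> parareal_rho L \<Delta>T \<alpha> ^ j * \<delta>"
    for j
  proof (induction j)
    case 0
    then show ?case
      using init N by (simp add: Max_le_iff)
  next
    case (Suc j)
    then show ?case
      using parareal_error_step[OF _ _ _ lip u \<tau>0 U[folded u0], where k = j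
          and M = "parareal_rho L \<Delta>T \<alpha> ^ j * \<delta>"] assms
      by (simp add: mult.assoc)
  qed
  show "(MAX n\<in>{1..N}. norm (u (time_node \<Delta>T n) \<xi> - U (k + 1) n \<xi>))
      \<le> parareal_rho L \<Delta>T \<alpha> ^ (k + 1) * \<delta>"
    using bound[of "k + 1"] N by (subst Max_le_iff) auto
qed simp

end
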